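(* Let $\beta>-d$ and let the density $f$ satisfy $f\in L^2(W)$. Then $$\mathbb{E} L_n(\beta) = \frac{n(n-1)}{2} \int_{W^2} \mathbf{1}\{\|x-y\|\leq r_n\} \, \|x-y\|^{\beta} \, f(x) \, f(y) \, \mathrm{d}(x,y)$$ and $$\lim_{n\to\infty} \frac{\mathbb{E} L_n(\beta)}{n^2 r_n^{\beta+d}}=\frac{d\kappa_d}{2(\beta+d)} \int_W f(x)^2 \, \mathrm{d}x.$$
   Context: Let $d\ge 1$ and let $W\subset\mathbb{R}^d$ be a measurable set with volume (Lebesgue measure) $\operatorname{Vol}(W)=1$. Let $f$ be a probability density on $\mathbb{R}^d$ whose support is contained in $W$. For $n\ge 2$ let $\mathscr{X}_n=\{X_1,\ldots,X_n\}$, where $X_1,\ldots,X_n$ are i.i.d. random vectors with density $f$. Let $(r_n)$ be a sequence of positive real numbers with $r_n\to0$ as $n\to\infty$. For $\beta\in\mathbb{R}$ define $$L_n(\beta):=\frac12\sum_{(x,y)\in\mathscr{X}^2_{n,\neq}}\mathbf{1}\{\|x-y\|\le r_n\}\,\|x-y\|^\beta,$$ where the sum is over all ordered pairs of distinct points of $\mathscr{X}_n$, $\|\cdot\|$ is the Euclidean norm and $\mathbf{1}\{\cdot\}$ is the indicator. $\kappa_d=\pi^{d/2}/\Gamma(d/2+1)$ is the volume of the $d$-dimensional unit ball. $L^p(W)$, $p>0$, is the space of measurable functions on $W$ for which the $p$-th power of the absolute value has finite Lebesgue integral. *)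

theory Defs
  imports "HOL-Probability.Probability"
begin

definition prob_density :: "('a :: euclidean_space \<Rightarrow> real) \<Rightarrow> bool" where
  "prob_density f \<longleftrightarrow>
     f \<in> borel_measurable borel \<and> (\<forall>x. 0 \<le> f x) \<and> (\<integral>\<^sup>+ x. ennreal (f x) \<partial>lborel) = 1"

text \<open>Elements are functions, not equivalence classes modulo null sets; only the values on
  the set \<open>W\<close> matter.\<close>

definition Lp_space :: "real \<Rightarrow> 'a :: euclidean_space set \<Rightarrow> ('a \<Rightarrow> real) set" where
  "Lp_space p W =
     {g. set_borel_measurable lebesgue W g \<and> set_integrable lebesgue W (\<lambda>x. \<bar>g x\<bar> powr p)}"

definition iid_with_density ::
    "'w measure \<Rightarrow> nat \<Rightarrow> (nat \<Rightarrow> 'w \<Rightarrow> 'a :: euclidean_space) \<Rightarrow> ('a \<Rightarrow> real) \<Rightarrow> bool" where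
  "iid_with_density M n X f \<longleftrightarrow>
     prob_space.indep_vars M (\<lambda>_. borel) X {1..n} \<and>
     (\<forall>i\<in>{1..n}. distributed M lborel (X i) (\<lambda>x. ennreal (f x)))"

definition sample_points :: "nat \<Rightarrow> (nat \<Rightarrow> 'w \<Rightarrow> 'a) \<Rightarrow> 'w \<Rightarrow> 'a set" where
  "sample_points n X \<omega> = (\<lambda>i. X i \<omega>) ` {1..n}"

definition distinct_pairs :: "'a set \<Rightarrow> ('a \<times> 'a) set" where
  "distinct_pairs P = {(x, y). x \<in> P \<and> y \<in> P \<and> x \<noteq> y}"

text \<open>The function \<open>1{\<parallel>x - y\<parallel> \<le> r} \<parallel>x - y\<parallel>\<^sup>\<beta>\<close>. On the diagonal \<open>powr\<close>
  gives \<open>0\<close> for every \<open>\<beta>\<close>; the diagonal is excluded from the sum below and is a null set for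
  double integrals.\<close>

definition edge_weight :: "real \<Rightarrow> real \<Rightarrow> 'a :: real_normed_vector \<Rightarrow> 'a \<Rightarrow> real" where
  "edge_weight r \<beta> x y = of_bool (norm (x - y) \<le> r) * norm (x - y) powr \<beta>"

definition L_sample ::
    "real \<Rightarrow> real \<Rightarrow> nat \<Rightarrow> (nat \<Rightarrow> 'w \<Rightarrow> 'a :: real_normed_vector) \<Rightarrow> 'w \<Rightarrow> real" where
  "L_sample r \<beta> n X \<omega> =
     1 / 2 * (\<Sum>(x, y)\<in>distinct_pairs (sample_points n X \<omega>). edge_weight r \<beta> x y)"

end

theory Submission
  imports Defs
begin

text \<open>
  The formula for the expectation holds because \<open>L_sample\<close> is almost surely half the sum of
  \<open>edge_weight r \<beta> (X i) (X j)\<close> over the pairs of distinct indices, and every such pair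
  \<open>(X i, X j)\<close> has the joint density \<open>f x * f y\<close>.  Two sample points coincide only on a null
  event, because the diagonal is a Lebesgue null set.

  For the limit, substitute \<open>y = x + z\<close> in the double integral.  It becomes
  \<open>\<integral> k z * g z dz\<close>, where \<open>k z = 1{\<parallel>z\<parallel> \<le> r} \<parallel>z\<parallel>\<^sup>\<beta>\<close> and \<open>g z = \<integral> f x * f (x + z) dx\<close> is
  the autocorrelation of \<open>f\<close>.  The kernel \<open>k\<close> has mass
  \<open>d * \<kappa> / (\<beta> + d) * r powr (\<beta> + d)\<close> (lemma \<open>nn_integral_edge_weight\<close>), with
  \<open>\<kappa>\<close> the volume of the unit ball, and is concentrated on the ball of radius \<open>r\<close>, so the integral divided by \<open>r powr (\<beta> + d)\<close> tends to
  \<open>d * \<kappa> / (\<beta> + d) * g 0\<close> as soon as \<open>g\<close> is continuous at \<open>0\<close>; and \<open>g 0 = \<integral> f\<^sup>2\<close>.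

  For the continuity of \<open>g\<close> at \<open>0\<close> (lemma \<open>tendsto_autocorrelation\<close>), the bound
  \<open>g z \<le> g 0\<close> follows from \<open>2ab \<le> a\<^sup>2 + b\<^sup>2\<close> and translation invariance, so only
  a lower bound near \<open>0\<close> is left.  Since \<open>f \<ge> 0\<close>, a lower bound may be taken from a simple
  function below \<open>f\<close>, and then from its level sets \<open>A\<close>, for which it says that the overlap of
  \<open>A\<close> with its translates by small vectors has almost the full measure of \<open>A\<close> (lemma
  \<open>tendsto_emeasure_overlap\<close>).
\<close>

section \<open>Radial integrals and the mass of the kernel\<close>

text \<open>Under Lebesgue measure the norm takes values in \<open>{..x}\<close>, \<open>x \<ge> 0\<close>, with
  measure \<open>\<kappa> * x ^ d\<close>, the volume of a ball, and the density is the derivative of that function.  This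
  replaces polar coordinates for radial integrands.\<close>

lemma distr_norm_lborel:
  "distr lborel borel (norm :: 'a::euclidean_space \<Rightarrow> real) =
     density lborel (\<lambda>t. ennreal (indicator {0..} t *
       (real DIM('a) * unit_ball_vol (real DIM('a)) * t powr (real DIM('a) - 1))))"
    (is "?N = ?D")
proof (rule measure_eqI_generator_eq[where E="range atMost" and \<Omega>=UNIV and A="\<lambda>n. {..real n}"])
  let ?d = "real DIM('a)" and ?\<kappa> = "unit_ball_vol (real DIM('a))"
  show "Int_stable (range atMost :: real set set)"
    by (auto simp: Int_stable_def)
  show "sets ?N = sigma_sets UNIV (range atMost)" "sets ?D = sigma_sets UNIV (range atMost)"
    by (simp_all add: borel_eq_atMost)
  have N: "emeasure ?N {..x} = ennreal (?\<kappa> * x ^ DIM('a))" if "x \<ge> 0" for x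
  proof -
    have "emeasure ?N {..x} = emeasure lborel (norm -` {..x} \<inter> space lborel :: 'a set)"
      by (rule emeasure_distr) auto
    also have "norm -` {..x} \<inter> space lborel = (cball 0 x :: 'a set)"
      by auto
    finally show ?thesis
      using that by (simp add: emeasure_cball)
  qed
  have D: "emeasure ?D {..x} = ennreal (?\<kappa> * x ^ DIM('a))" if "x \<ge> 0" for x
  proof -
    have "((\<lambda>t. t powr (?d - 1)) has_integral (x powr (?d - 1 + 1) / (?d - 1 + 1))) {0..x}"
      using that by (intro has_integral_powr_from_0) auto
    hence "((\<lambda>t. ?d * ?\<kappa> * t powr (?d - 1)) has_integral (?d * ?\<kappa> * (x powr ?d / ?d))) {0..x}"
      by (intro has_integral_mult_right) simp
    hence "((\<lambda>t. if t \<in> {0..x} then ?d * ?\<kappa> * t powr (?d - 1) else 0) has_integral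
             (?d * ?\<kappa> * (x powr ?d / ?d))) UNIV"
      by (subst has_integral_restrict_UNIV)
    also have "(\<lambda>t. if t \<in> {0..x} then ?d * ?\<kappa> * t powr (?d - 1) else 0) =
        (\<lambda>t. indicator {0..x} t * (?d * ?\<kappa> * t powr (?d - 1)))"
      by (auto simp: indicator_def)
    also have "?d * ?\<kappa> * (x powr ?d / ?d) = ?\<kappa> * x ^ DIM('a)"
      using that by (cases "x = 0") (auto simp: powr_realpow)
    finally have "(\<integral>\<^sup>+t. ennreal (indicator {0..x} t * (?d * ?\<kappa> * t powr (?d - 1))) \<partial>lborel) =
        ennreal (?\<kappa> * x ^ DIM('a))"
      by (intro nn_integral_has_integral_lborel) (auto simp: unit_ball_vol_nonneg)
    also have "(\<integral>\<^sup>+t. ennreal (indicator {0..x} t * (?d * ?\<kappa> * t powr (?d - 1))) \<partial>lborel) = 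
       emeasure ?D {..x}"
      by (subst emeasure_density)
        (auto intro!: nn_integral_cong simp: indicator_def)
    finally show ?thesis .
  qed
  show "emeasure ?N Y = emeasure ?D Y" if Y: "Y \<in> range atMost" for Y
  proof -
    from Y obtain x where [simp]: "Y = {..x}" by auto
    show ?thesis
    proof (cases "x \<ge> 0")
      case True
      thus ?thesis by (simp add: N D)
    next
      case False
      hence "norm -` {..x} = ({} :: 'a set)"
        by auto (meson norm_ge_zero order_trans)
      hence "emeasure ?N {..x} = 0"
        by (subst emeasure_distr) auto
      moreover have "emeasure ?D {..x} = 0"
        using False by (subst emeasure_density) (auto simp: nn_integral_0_iff_AE indicator_def)
      ultimately show ?thesis by simp
    qed
  qed
  show "emeasure ?N {..real n} \<noteq> \<infinity>" for n
    by (simp add: N)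
  show "(\<Union>n. {..real n}) = UNIV"
    using real_arch_simple by auto
qed auto

lemma edge_weight_nonneg [simp]: "0 \<le> edge_weight r \<beta> x y"
  by (simp add: edge_weight_def)

lemma edge_weight_self [simp]: "edge_weight r \<beta> x x = 0"
  by (simp add: edge_weight_def)

lemma edge_weight_translate: "edge_weight r \<beta> x (x + z) = edge_weight r \<beta> z 0"
  by (simp add: edge_weight_def)

lemma measurable_edge_weight [measurable (raw)]:
  fixes u v :: "'b \<Rightarrow> 'a::euclidean_space"
  assumes [measurable]: "u \<in> borel_measurable N" "v \<in> borel_measurable N"
  shows "(\<lambda>x. edge_weight r \<beta> (u x) (v x)) \<in> borel_measurable N"
  unfolding edge_weight_def by measurable

text \<open>The condition \<open>\<beta> > - d\<close> is what makes \<open>t powr (\<beta> + d - 1)\<close> integrable at \<open>0\<close>.\<close>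

lemma nn_integral_edge_weight:
  assumes r: "r > 0" and \<beta>: "\<beta> > - real DIM('a)"
  shows "(\<integral>\<^sup>+z. ennreal (edge_weight r \<beta> (z::'a::euclidean_space) 0) \<partial>lborel) =
    ennreal (real DIM('a) * unit_ball_vol (real DIM('a)) / (\<beta> + real DIM('a))
              * r powr (\<beta> + real DIM('a)))"
proof -
  let ?d = "real DIM('a)" and ?\<kappa> = "unit_ball_vol (real DIM('a))"
  have "(\<integral>\<^sup>+z. ennreal (edge_weight r \<beta> (z::'a) 0) \<partial>lborel) =
      (\<integral>\<^sup>+t. ennreal (of_bool (t \<le> r) * t powr \<beta>) \<partial>distr lborel borel (norm :: 'a \<Rightarrow> real))"
    by (subst nn_integral_distr) (auto simp: edge_weight_def)
  also have "\<dots> = (\<integral>\<^sup>+t. ennreal (indicator {0..r} t * (?d * ?\<kappa> * t powr (\<beta> + ?d - 1))) \<partial>lborel)"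
    unfolding distr_norm_lborel
    by (subst nn_integral_density)
      (auto intro!: nn_integral_cong
            simp: indicator_def unit_ball_vol_nonneg ennreal_mult'[symmetric] powr_diff powr_add)
  also have "\<dots> = ennreal (?d * ?\<kappa> * (r powr (\<beta> + ?d) / (\<beta> + ?d)))"
  proof (rule nn_integral_has_integral_lborel)
    have "((\<lambda>t. t powr (\<beta> + ?d - 1)) has_integral (r powr (\<beta> + ?d - 1 + 1) / (\<beta> + ?d - 1 + 1))) {0..r}"
      using r \<beta> by (intro has_integral_powr_from_0) auto
    hence "((\<lambda>t. ?d * ?\<kappa> * t powr (\<beta> + ?d - 1)) has_integral
        (?d * ?\<kappa> * (r powr (\<beta> + ?d) / (\<beta> + ?d)))) {0..r}"
      by (intro has_integral_mult_right) simp
    hence "((\<lambda>t. if t \<in> {0..r} then ?d * ?\<kappa> * t powr (\<beta> + ?d - 1) else 0) has_integral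
             (?d * ?\<kappa> * (r powr (\<beta> + ?d) / (\<beta> + ?d)))) UNIV"
      by (subst has_integral_restrict_UNIV)
    also have "(\<lambda>t. if t \<in> {0..r} then ?d * ?\<kappa> * t powr (\<beta> + ?d - 1) else 0) =
        (\<lambda>t. indicator {0..r} t * (?d * ?\<kappa> * t powr (\<beta> + ?d - 1)))"
      by (auto simp: indicator_def)
    finally show "((\<lambda>t. indicator {0..r} t * (?d * ?\<kappa> * t powr (\<beta> + ?d - 1))) has_integral
             (?d * ?\<kappa> * (r powr (\<beta> + ?d) / (\<beta> + ?d)))) UNIV" .
  qed (auto simp: unit_ball_vol_nonneg)
  finally show ?thesis
    by simp
qed

section \<open>Continuity of the autocorrelation at zero\<close>

lemma nn_integral_lborel_shift:
  fixes h :: "'a::euclidean_space \<Rightarrow> ennreal"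
  assumes [measurable]: "h \<in> borel_measurable borel"
  shows "(\<integral>\<^sup>+x. h (c + x) \<partial>lborel) = (\<integral>\<^sup>+x. h x \<partial>lborel)"
  by (subst (2) lborel_distr_plus[of c, symmetric], subst nn_integral_distr) auto

text \<open>Squeeze \<open>A\<close> from inside by a compact \<open>K\<close> and \<open>K\<close> from outside by an open \<open>U\<close> of almost
  the same measure.  For small \<open>z\<close> the translate of \<open>K\<close> still lies in \<open>U\<close>, and two subsets of
  \<open>U\<close> of measure close to that of \<open>U\<close> must overlap almost entirely.\<close>

lemma tendsto_emeasure_overlap:
  fixes A :: "'a::euclidean_space set"
  assumes A[measurable]: "A \<in> sets borel" and fin: "emeasure lborel A < \<infinity>"
  shows "((\<lambda>z. emeasure lborel {x \<in> A. z + x \<in> A}) \<longlongrightarrow> emeasure lborel A) (nhds 0)"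
proof (rule order_tendstoI)
  fix a assume "a < emeasure lborel A"
  \<comment> \<open>Inner regularity is available for finite measures, so restrict Lebesgue measure to \<open>A\<close>.\<close>
  define \<mu> where "\<mu> = density lborel (indicator A :: 'a \<Rightarrow> ennreal)"
  have \<mu>: "emeasure \<mu> B = emeasure lborel (A \<inter> B)" if "B \<in> sets borel" for B
    unfolding \<mu>_def using that by (subst emeasure_density) (auto simp: indicator_inter_arith[symmetric])
  have "emeasure \<mu> A = (SUP K \<in> {K. K \<subseteq> A \<and> compact K}. emeasure \<mu> K)"
  proof (rule inner_regular)
    show "emeasure \<mu> (space \<mu>) \<noteq> \<infinity>"
      using fin by (simp add: \<mu> \<mu>_def space_density) (simp add: \<mu>[unfolded \<mu>_def])
  qed (auto simp: \<mu>_def)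
  with \<open>a < emeasure lborel A\<close> obtain K where K: "K \<subseteq> A" "compact K" "a < emeasure \<mu> K"
    by (auto simp: \<mu> less_SUP_iff)
  have [measurable]: "K \<in> sets borel"
    using K(2) by (simp add: borel_compact)
  have aK: "a < emeasure lborel K"
    using K by (simp add: \<mu> Int_absorb1)
  have Kfin: "emeasure lborel K < \<infinity>"
    using emeasure_mono[OF K(1), of lborel] fin by auto
  then obtain e :: real where e: "e > 0" "a + ennreal e < emeasure lborel K"
  proof -
    have "a < \<infinity>"
      using aK Kfin by (rule less_trans)
    then obtain a' k where [simp]: "a = ennreal a'" "a' \<ge> 0" "emeasure lborel K = ennreal k" "k \<ge> 0"
      using Kfin by (cases a; cases "emeasure lborel K") auto
    have "a' < k"
      using aK by (simp add: ennreal_less_iff)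
    thus ?thesis
      by (intro that[of "(k - a') / 2"])
        (auto simp: ennreal_plus[symmetric] ennreal_less_iff field_simps simp del: ennreal_plus)
  qed
  obtain U where U: "open U" "K \<subseteq> U" "emeasure lborel (U - K) < e"
    using outer_regular_lborel[of K e] e by auto
  obtain \<delta> where \<delta>: "\<delta> > 0" "(\<Union>x\<in>K. ball x \<delta>) \<subseteq> U"
    using compact_subset_open_imp_ball_epsilon_subset[OF K(2) U(1,2)] by blast
  show "\<forall>\<^sub>F z in nhds 0. a < emeasure lborel {x \<in> A. z + x \<in> A}"
    unfolding eventually_nhds_metric
  proof (intro exI conjI allI impI)
    show "\<delta> > 0" by fact
    fix z :: 'a assume z: "dist z 0 < \<delta>"
    define K' where "K' = {x. z + x \<in> K}"
    have [measurable]: "K' \<in> sets borel"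
      unfolding K'_def by measurable
    have "K' \<subseteq> U"
    proof
      fix x assume "x \<in> K'"
      hence "x \<in> (\<Union>y\<in>K. ball y \<delta>)"
        using z by (intro UN_I[of "z + x"]) (auto simp: K'_def dist_norm)
      thus "x \<in> U" using \<delta>(2) by (rule set_rev_mp)
    qed
    have "emeasure lborel K' = (\<integral>\<^sup>+x. indicator K (z + x) \<partial>lborel)"
    proof -
      have "indicator K (z + x) = (indicator K' x :: ennreal)" for x
        by (simp add: K'_def indicator_def)
      thus ?thesis by simp
    qed
    also have "\<dots> = emeasure lborel K"
      by (subst nn_integral_lborel_shift) auto
    finally have K': "emeasure lborel K' = emeasure lborel K" .
    have "emeasure lborel K + emeasure lborel K = emeasure lborel (K \<union> K') + emeasure lborel (K \<inter> K')"
      using emeasure_Un_Int[of K lborel K'] K' by simp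
    also have "\<dots> \<le> emeasure lborel U + emeasure lborel (K \<inter> K')"
      using U \<open>K' \<subseteq> U\<close> by (intro add_mono emeasure_mono) auto
    also have "emeasure lborel U = emeasure lborel K + emeasure lborel (U - K)"
      using U by (subst plus_emeasure) (auto intro: arg_cong[of _ _ "emeasure lborel"])
    also have "\<dots> \<le> emeasure lborel K + e"
      using U by (intro add_mono) auto
    finally have "emeasure lborel K \<le> e + emeasure lborel (K \<inter> K')"
      using Kfin by (auto simp: add.assoc)
    with e(2) have "a + e < e + emeasure lborel (K \<inter> K')"
      by (rule less_le_trans)
    hence "a < emeasure lborel (K \<inter> K')"
      by (metis add.commute add_left_mono not_le)
    also have "\<dots> \<le> emeasure lborel {x \<in> A. z + x \<in> A}"
      using K(1) by (intro emeasure_mono) (auto simp: K'_def)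
    finally show "a < emeasure lborel {x \<in> A. z + x \<in> A}" .
  qed
next
  fix a assume "emeasure lborel A < a"
  have "emeasure lborel {x \<in> A. z + x \<in> A} \<le> emeasure lborel A" for z
    by (intro emeasure_mono) auto
  with \<open>emeasure lborel A < a\<close> show "\<forall>\<^sub>F z in nhds 0. emeasure lborel {x \<in> A. z + x \<in> A} < a"
    by (auto intro!: always_eventually intro: le_less_trans)
qed

lemma autocorrelation_le:
  fixes f :: "'a::euclidean_space \<Rightarrow> real"
  assumes f[measurable]: "f \<in> borel_measurable borel" and nonneg: "\<And>x. 0 \<le> f x"
  shows "(\<integral>\<^sup>+x. ennreal (f x * f (z + x)) \<partial>lborel) \<le> (\<integral>\<^sup>+x. ennreal ((f x)\<^sup>2) \<partial>lborel)"
proof -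
  let ?Q = "\<integral>\<^sup>+x. ennreal ((f x)\<^sup>2) \<partial>lborel"
  have "2 * (\<integral>\<^sup>+x. ennreal (f x * f (z + x)) \<partial>lborel) = (\<integral>\<^sup>+x. ennreal (2 * (f x * f (z + x))) \<partial>lborel)"
    by (subst ennreal_mult') (auto simp: nn_integral_cmult)
  also have "\<dots> \<le> (\<integral>\<^sup>+x. ennreal ((f x)\<^sup>2) + ennreal ((f (z + x))\<^sup>2) \<partial>lborel)"
    using sum_squares_bound
    by (intro nn_integral_mono) (auto simp: ennreal_plus[symmetric] mult.assoc simp del: ennreal_plus intro!: ennreal_leI)
  also have "\<dots> = ?Q + ?Q"
    by (subst nn_integral_add) (auto simp: nn_integral_lborel_shift[of "\<lambda>x. ennreal ((f x)\<^sup>2)"])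
  also have "\<dots> = 2 * ?Q"
    by (simp add: mult_2)
  finally show ?thesis
    by (subst (asm) ennreal_mult_le_mult_iff) auto
qed

text \<open>Dropping the products of different level sets loses nothing at \<open>z = 0\<close>, since level
  sets are disjoint; hence the lower bound by the overlaps of single level sets is sharp in the
  limit.\<close>

lemma tendsto_autocorrelation:
  fixes f :: "'a::euclidean_space \<Rightarrow> real"
  assumes f[measurable]: "f \<in> borel_measurable borel" and nonneg: "\<And>x. 0 \<le> f x"
    and fin: "(\<integral>\<^sup>+x. ennreal ((f x)\<^sup>2) \<partial>lborel) < \<infinity>"
  shows "((\<lambda>z. \<integral>\<^sup>+x. ennreal (f x * f (z + x)) \<partial>lborel) \<longlongrightarrow> 
           (\<integral>\<^sup>+x. ennreal ((f x)\<^sup>2) \<partial>lborel)) (nhds 0)"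
proof (rule order_tendstoI)
  let ?Q = "\<integral>\<^sup>+x. ennreal ((f x)\<^sup>2) \<partial>lborel"
  fix c assume c: "c < ?Q"
  obtain F where F: "\<And>i. simple_function borel (F i)" "incseq F" "\<And>i x. F i x < top"
      "\<And>x. (SUP i. F i x) = ennreal (f x)"
    by (rule borel_measurable_implies_simple_function_sequence'[of "\<lambda>x. ennreal (f x)" borel]) auto
  have [measurable]: "F i \<in> borel_measurable borel" for i
    using F(1) by (rule borel_measurable_simple_function)
  have Ff: "F i x \<le> ennreal (f x)" for i x
    unfolding F(4)[symmetric] by (rule SUP_upper) auto
  have "?Q = (\<integral>\<^sup>+x. (SUP i. F i x * F i x) \<partial>lborel)"
  proof (rule nn_integral_cong)
    fix x
    have "(SUP i. F i x * F i x) = (SUP i. F i x) * (SUP i. F i x)"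
    proof (rule LIMSEQ_unique[OF LIMSEQ_SUP])
      show "incseq (\<lambda>i. F i x * F i x)"
        using F(2) by (auto simp: incseq_def le_fun_def intro!: mult_mono)
      have "incseq (\<lambda>i. F i x)"
        using F(2) by (auto simp: incseq_def le_fun_def)
      hence "(\<lambda>i. F i x) \<longlonglongrightarrow> (SUP i. F i x)"
        by (rule LIMSEQ_SUP)
      thus "(\<lambda>i. F i x * F i x) \<longlonglongrightarrow> (SUP i. F i x) * (SUP i. F i x)"
        by (intro tendsto_mult_ennreal) (auto simp: F(4))
    qed
    thus "ennreal ((f x)\<^sup>2) = (SUP i. F i x * F i x)"
      using nonneg[of x] by (simp add: F(4) power2_eq_square ennreal_mult)
  qed
  also have "\<dots> = (SUP i. \<integral>\<^sup>+x. F i x * F i x \<partial>lborel)"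
    using F(2) by (intro nn_integral_monotone_convergence_SUP)
      (auto simp: incseq_def le_fun_def intro!: mult_mono)
  finally obtain i where i: "c < (\<integral>\<^sup>+x. F i x * F i x \<partial>lborel)"
    using c by (auto simp: less_SUP_iff)
  define s where "s = F i"
  have s: "simple_function lborel s"
    using F(1)[of i] by (simp add: s_def simple_function_def)
  have [measurable]: "s \<in> borel_measurable borel" by (simp add: s_def)
  have s_fin: "s x < top" for x by (simp add: s_def F)
  have ran: "finite (range s)"
    using s by (simp add: simple_function_def)
  define A where "A a = {x. s x = a}" for a
  have [measurable]: "A a \<in> sets borel" for a
    unfolding A_def by measurable
  have s_sum: "s x * g x = (\<Sum>a\<in>range s. a * indicator (A a) x * g x)" for x and g :: "'a \<Rightarrow> ennreal"
    using ran by (subst sum.remove[of _ "s x"]) (auto simp: A_def indicator_def)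
  let ?h = "\<lambda>z. \<Sum>a\<in>range s. a * a * emeasure lborel {x \<in> A a. z + x \<in> A a}"
  have "(\<integral>\<^sup>+x. s x * s x \<partial>lborel) = (\<integral>\<^sup>+x. (\<Sum>a\<in>range s. a * a * indicator (A a) x) \<partial>lborel)"
    by (intro nn_integral_cong, subst s_sum) (auto simp: A_def indicator_def intro!: sum.cong)
  also have "\<dots> = (\<Sum>a\<in>range s. a * a * emeasure lborel (A a))"
    by (subst nn_integral_sum) (auto simp: nn_integral_cmult_indicator)
  finally have sq: "(\<integral>\<^sup>+x. s x * s x \<partial>lborel) = (\<Sum>a\<in>range s. a * a * emeasure lborel (A a))" .
  have "(?h \<longlongrightarrow> (\<integral>\<^sup>+x. s x * s x \<partial>lborel)) (nhds 0)"
    unfolding sq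
  proof (rule tendsto_sum)
    fix a assume a: "a \<in> range s"
    show "((\<lambda>z. a * a * emeasure lborel {x \<in> A a. z + x \<in> A a}) \<longlongrightarrow> a * a * emeasure lborel (A a)) (nhds 0)"
      \<comment> \<open>Only the level set of \<open>0\<close> can have infinite measure, and its weight vanishes.\<close>
    proof (cases "a = 0")
      case False
      have "a < top" using a s_fin by auto
      have "a * a * emeasure lborel (A a) = (\<integral>\<^sup>+x. a * a * indicator (A a) x \<partial>lborel)"
        by (simp add: nn_integral_cmult_indicator)
      also have "\<dots> \<le> ?Q"
      proof (rule nn_integral_mono)
        fix x
        show "a * a * indicator (A a) x \<le> ennreal ((f x)\<^sup>2)"
          using nonneg[of x] Ff[of i x]
          by (auto simp: indicator_def A_def power2_eq_square ennreal_mult s_def intro!: mult_mono)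
      qed
      also note fin
      finally have "emeasure lborel (A a) < \<infinity>"
        using False by (auto simp: ennreal_mult_less_top)
      hence "((\<lambda>z. emeasure lborel {x \<in> A a. z + x \<in> A a}) \<longlongrightarrow> emeasure lborel (A a)) (nhds 0)"
        by (intro tendsto_emeasure_overlap) auto
      thus ?thesis
        using \<open>a < top\<close> by (intro ennreal_tendsto_cmult) (auto simp: ennreal_mult_less_top)
    qed auto
  qed
  hence "\<forall>\<^sub>F z in nhds 0. c < ?h z"
    using i by (intro order_tendstoD) (auto simp: s_def)
  thus "\<forall>\<^sub>F z in nhds 0. c < (\<integral>\<^sup>+x. ennreal (f x * f (z + x)) \<partial>lborel)"
  proof eventually_elim
    fix z assume "c < ?h z"
    also have "?h z = (\<integral>\<^sup>+x. (\<Sum>a\<in>range s. a * a * indicator {x \<in> A a. z + x \<in> A a} x) \<partial>lborel)"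
      by (subst nn_integral_sum) (auto simp: nn_integral_cmult_indicator)
    also have "\<dots> \<le> (\<integral>\<^sup>+x. s x * s (z + x) \<partial>lborel)"
      by (intro nn_integral_mono, subst s_sum, intro sum_mono) (auto simp: A_def indicator_def)
    also have "\<dots> \<le> (\<integral>\<^sup>+x. ennreal (f x * f (z + x)) \<partial>lborel)"
      using nonneg Ff by (intro nn_integral_mono) (auto simp: ennreal_mult s_def intro!: mult_mono)
    finally show "c < (\<integral>\<^sup>+x. ennreal (f x * f (z + x)) \<partial>lborel)" .
  qed
next
  fix c assume c: "(\<integral>\<^sup>+x. ennreal ((f x)\<^sup>2) \<partial>lborel) < c"
  have "(\<integral>\<^sup>+x. ennreal (f x * f (z + x)) \<partial>lborel) < c" for z
    using autocorrelation_le[OF f nonneg] c by (rule le_less_trans)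
  thus "\<forall>\<^sub>F z in nhds 0. (\<integral>\<^sup>+x. ennreal (f x * f (z + x)) \<partial>lborel) < c"
    by simp
qed

section \<open>Asymptotics of the double integral\<close>

lemma nn_integral_edge_weight_density:
  fixes f :: "'a::euclidean_space \<Rightarrow> real"
  assumes f[measurable]: "f \<in> borel_measurable borel" and nonneg: "\<And>x. 0 \<le> f x"
  shows "(\<integral>\<^sup>+x. \<integral>\<^sup>+y. ennreal (edge_weight r \<beta> x y * f x * f y) \<partial>lborel \<partial>lborel) =
    (\<integral>\<^sup>+z. ennreal (edge_weight r \<beta> z 0) * (\<integral>\<^sup>+x. ennreal (f x * f (z + x)) \<partial>lborel) \<partial>lborel)"
proof -
  have "(\<integral>\<^sup>+x. \<integral>\<^sup>+y. ennreal (edge_weight r \<beta> x y * f x * f y) \<partial>lborel \<partial>lborel) = 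
      (\<integral>\<^sup>+x. \<integral>\<^sup>+z. ennreal (edge_weight r \<beta> z 0 * (f x * f (z + x))) \<partial>lborel \<partial>lborel)"
  proof (rule nn_integral_cong)
    fix x :: 'a
    have "(\<integral>\<^sup>+y. ennreal (edge_weight r \<beta> x y * f x * f y) \<partial>lborel) =
        (\<integral>\<^sup>+z. ennreal (edge_weight r \<beta> x (x + z) * f x * f (x + z)) \<partial>lborel)"
      by (rule nn_integral_lborel_shift[symmetric]) measurable
    thus "(\<integral>\<^sup>+y. ennreal (edge_weight r \<beta> x y * f x * f y) \<partial>lborel) =
        (\<integral>\<^sup>+z. ennreal (edge_weight r \<beta> z 0 * (f x * f (z + x))) \<partial>lborel)"
      by (simp add: edge_weight_translate mult.assoc) (simp add: add.commute)
  qed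
  also have "\<dots> = (\<integral>\<^sup>+z. \<integral>\<^sup>+x. ennreal (edge_weight r \<beta> z 0 * (f x * f (z + x))) \<partial>lborel \<partial>lborel)"
    by (rule lborel_pair.Fubini') simp
  also have "\<dots> = (\<integral>\<^sup>+z. ennreal (edge_weight r \<beta> z 0) * (\<integral>\<^sup>+x. ennreal (f x * f (z + x)) \<partial>lborel) \<partial>lborel)"
    using nonneg by (simp add: ennreal_mult nn_integral_cmult)
  finally show ?thesis .
qed


text \<open>The two bounds come from the same representation: \<open>g \<le> q\<close> everywhere for the
  autocorrelation \<open>g\<close>, and \<open>g\<close> exceeds any \<open>b < q\<close> on the support of the kernel once its radius
  is small.  The first bound also shows that the double integral is finite.\<close>

lemma edge_weight_density_asymptotics:
  fixes f :: "'a::euclidean_space \<Rightarrow> real" and r :: "nat \<Rightarrow> real" and \<beta> :: real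
  defines "C \<equiv> real DIM('a) * unit_ball_vol (real DIM('a)) / (\<beta> + real DIM('a))"
  defines "J \<equiv> \<lambda>r. \<integral>\<^sup>+x. \<integral>\<^sup>+y. ennreal (edge_weight r \<beta> x y * f x * f y) \<partial>lborel \<partial>lborel"
  assumes f[measurable]: "f \<in> borel_measurable borel" and nonneg: "\<And>x. 0 \<le> f x"
    and Q: "(\<integral>\<^sup>+x. ennreal ((f x)\<^sup>2) \<partial>lborel) = ennreal q" "q \<ge> 0"
    and \<beta>: "\<beta> > - real DIM('a)"
  shows edge_weight_density_le: "s > 0 \<Longrightarrow> J s \<le> ennreal (C * s powr (\<beta> + real DIM('a)) * q)"
    and edge_weight_density_tendsto: "r \<longlonglongrightarrow> 0 \<Longrightarrow> eventually (\<lambda>n. r n > 0) sequentially \<Longrightarrow>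
           (\<lambda>n. enn2real (J (r n)) / r n powr (\<beta> + real DIM('a))) \<longlonglongrightarrow> C * q"
proof -
  let ?k = "\<lambda>s z. ennreal (edge_weight s \<beta> (z::'a) 0)"
  let ?g = "\<lambda>z. \<integral>\<^sup>+x. ennreal (f x * f (z + x)) \<partial>lborel"
  have C: "C > 0"
    using \<beta> by (simp add: C_def)
  have mass: "(\<integral>\<^sup>+z. ?k s z \<partial>lborel) = ennreal (C * s powr (\<beta> + real DIM('a)))" if "s > 0" for s
    using nn_integral_edge_weight[OF that \<beta>] by (simp add: C_def)
  have J: "J s = (\<integral>\<^sup>+z. ?k s z * ?g z \<partial>lborel)" for s
    unfolding J_def by (rule nn_integral_edge_weight_density[OF f nonneg])
  have upper: "J s \<le> ennreal (C * s powr (\<beta> + real DIM('a)) * q)" if "s > 0" for s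
  proof -
    have "J s \<le> (\<integral>\<^sup>+z. ?k s z * ennreal q \<partial>lborel)"
      unfolding J Q(1)[symmetric]
      by (intro nn_integral_mono mult_left_mono autocorrelation_le f nonneg) auto
    also have "\<dots> = ennreal (C * s powr (\<beta> + real DIM('a))) * ennreal q"
      by (subst nn_integral_multc) (simp_all add: mass[OF that])
    finally show ?thesis
      using C Q(2) by (simp add: ennreal_mult)
  qed
  thus "s > 0 \<Longrightarrow> J s \<le> ennreal (C * s powr (\<beta> + real DIM('a)) * q)" .

  assume r: "r \<longlonglongrightarrow> 0" "eventually (\<lambda>n. r n > 0) sequentially"
  show "(\<lambda>n. enn2real (J (r n)) / r n powr (\<beta> + real DIM('a))) \<longlonglongrightarrow> C * q"
  proof (rule order_tendstoI)
    fix a assume "C * q < a"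
    show "\<forall>\<^sub>F n in sequentially. enn2real (J (r n)) / r n powr (\<beta> + real DIM('a)) < a"
      using r(2)
    proof eventually_elim
      case (elim n)
      have "enn2real (J (r n)) \<le> C * r n powr (\<beta> + real DIM('a)) * q"
        using C Q(2) by (intro enn2real_leI upper elim) auto
      hence "enn2real (J (r n)) / r n powr (\<beta> + real DIM('a)) \<le> C * q"
        using elim by (simp add: field_simps)
      thus ?case
        using \<open>C * q < a\<close> by simp
    qed
  next
    fix a assume a: "a < C * q"
    show "\<forall>\<^sub>F n in sequentially. a < enn2real (J (r n)) / r n powr (\<beta> + real DIM('a))"
    proof (cases "a < 0")
      case True
      show ?thesis
        using True by (intro always_eventually allI) (auto intro: less_le_trans[of _ 0])
    next
      case False
      obtain b where b: "a / C < b" "b < q"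
        using dense[of "a / C" q] a C by (auto simp: field_simps)
      have "b > 0"
        using b False C by (auto intro: le_less_trans[of 0 "a / C"])
      have "(?g \<longlongrightarrow> ennreal q) (nhds 0)"
        using tendsto_autocorrelation[OF f nonneg] by (simp add: Q)
      hence "\<forall>\<^sub>F z in nhds 0. ennreal b < ?g z"
        using b \<open>b > 0\<close> by (intro order_tendstoD) (auto simp: ennreal_less_iff)
      then obtain \<delta> where \<delta>: "\<delta> > 0" "\<And>z. norm z < \<delta> \<Longrightarrow> ennreal b < ?g z"
        by (auto simp: eventually_nhds_metric)
      have "\<forall>\<^sub>F n in sequentially. r n < \<delta>"
        using r(1) \<delta>(1) by (rule order_tendstoD)
      with r(2) show ?thesis
      proof eventually_elim
        case (elim n)
        let ?p = "r n powr (\<beta> + real DIM('a))"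
        have "ennreal (C * ?p * b) = ennreal (C * ?p) * ennreal b"
          using C \<open>b > 0\<close> by (simp add: ennreal_mult)
        also have "\<dots> = (\<integral>\<^sup>+z. ?k (r n) z * ennreal b \<partial>lborel)"
          by (subst nn_integral_multc) (simp_all add: mass elim)
        also have "\<dots> \<le> J (r n)"
          unfolding J
        proof (rule nn_integral_mono)
          fix z :: 'a
          show "?k (r n) z * ennreal b \<le> ?k (r n) z * ?g z"
          proof (cases "norm z \<le> r n")
            case True
            thus ?thesis
              using \<delta>(2)[of z] elim by (intro mult_left_mono) auto
          qed (simp add: edge_weight_def)
        qed
        finally have "enn2real (ennreal (C * ?p * b)) \<le> enn2real (J (r n))"
          using upper[OF elim(1)] by (intro enn2real_mono) (auto intro: le_less_trans)
        hence "C * ?p * b \<le> enn2real (J (r n))"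
          using C \<open>b > 0\<close> by simp
        hence "C * b \<le> enn2real (J (r n)) / ?p"
          using elim by (simp add: field_simps)
        moreover have "a < C * b"
          using b(1) C by (simp add: field_simps)
        ultimately show ?case by simp
      qed
    qed
  qed
qed

section \<open>Expectation over the sample\<close>

text \<open>The sum in \<open>L_sample\<close> runs over the set of values of the sample, which itself depends on
  \<open>\<omega>\<close>.  Choosing the first index at which each value occurs turns it into a sum over fixed
  indices, valid at every \<open>\<omega>\<close>, even where points coincide.  This gives measurability on a measure
  space that need not be complete, where agreement almost everywhere would not suffice.  Diagonal
  terms may be included because \<open>edge_weight\<close> vanishes there.\<close>

lemma L_sample_eq_sum_first_indices:
  "L_sample r \<beta> n X \<omega> = 1 / 2 * (\<Sum>i\<in>{1..n}. \<Sum>j\<in>{1..n}.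
     of_bool (\<forall>k\<in>{1..<i}. X k \<omega> \<noteq> X i \<omega>) * of_bool (\<forall>k\<in>{1..<j}. X k \<omega> \<noteq> X j \<omega>) *
     edge_weight r \<beta> (X i \<omega>) (X j \<omega>))"
proof -
  define I where "I = {i\<in>{1..n}. \<forall>k\<in>{1..<i}. X k \<omega> \<noteq> X i \<omega>}"
  define P where "P = sample_points n X \<omega>"
  have inj: "inj_on (\<lambda>i. X i \<omega>) I"
    unfolding I_def inj_on_def by (smt (verit) atLeastAtMost_iff atLeastLessThan_iff linorder_neqE_nat mem_Collect_eq)
  have P: "P = (\<lambda>i. X i \<omega>) ` I"
  proof (intro equalityI subsetI)
    fix x assume "x \<in> P"
    then obtain i where i: "i \<in> {1..n}" "X i \<omega> = x"
      by (auto simp: P_def sample_points_def)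
    define l where "l = (LEAST i. i \<in> {1..n} \<and> X i \<omega> = x)"
    have l: "l \<in> {1..n} \<and> X l \<omega> = x"
      unfolding l_def by (rule LeastI[of _ i]) (use i in auto)
    have "X k \<omega> \<noteq> X l \<omega>" if "k \<in> {1..<l}" for k
      using not_less_Least[of k "\<lambda>i. i \<in> {1..n} \<and> X i \<omega> = x"] that l
      unfolding l_def[symmetric] by auto
    with l show "x \<in> (\<lambda>i. X i \<omega>) ` I"
      unfolding I_def by auto
  qed (auto simp: P_def sample_points_def I_def)
  have filter: "(\<Sum>i\<in>I. g i) = (\<Sum>i\<in>{1..n}. of_bool (\<forall>k\<in>{1..<i}. X k \<omega> \<noteq> X i \<omega>) * g i)" for g :: "nat \<Rightarrow> real"
    by (rule sum.mono_neutral_cong_left) (auto simp: I_def)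
  have "finite P" by (simp add: P_def sample_points_def)
  have "(\<Sum>(x, y)\<in>distinct_pairs P. edge_weight r \<beta> x y) = (\<Sum>(x, y)\<in>P \<times> P. edge_weight r \<beta> x y)"
    using \<open>finite P\<close> by (intro sum.mono_neutral_left) (auto simp: distinct_pairs_def)
  also have "\<dots> = (\<Sum>x\<in>P. \<Sum>y\<in>P. edge_weight r \<beta> x y)"
    by (simp add: sum.cartesian_product)
  also have "\<dots> = (\<Sum>i\<in>I. \<Sum>j\<in>I. edge_weight r \<beta> (X i \<omega>) (X j \<omega>))"
    unfolding P by (simp add: sum.reindex[OF inj])
  also have "\<dots> = (\<Sum>i\<in>{1..n}. of_bool (\<forall>k\<in>{1..<i}. X k \<omega> \<noteq> X i \<omega>) *
     (\<Sum>j\<in>{1..n}. of_bool (\<forall>k\<in>{1..<j}. X k \<omega> \<noteq> X j \<omega>) * edge_weight r \<beta> (X i \<omega>) (X j \<omega>)))"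
    by (simp add: filter)
  also have "\<dots> = (\<Sum>i\<in>{1..n}. \<Sum>j\<in>{1..n}.
      of_bool (\<forall>k\<in>{1..<i}. X k \<omega> \<noteq> X i \<omega>) * of_bool (\<forall>k\<in>{1..<j}. X k \<omega> \<noteq> X j \<omega>) *
      edge_weight r \<beta> (X i \<omega>) (X j \<omega>))"
    by (simp only: sum_distrib_left mult.assoc)
  finally show ?thesis
    by (simp only: L_sample_def P_def)
qed

lemma (in prob_space) indep_var_of_indep_vars:
  assumes "indep_vars (\<lambda>_. N) X I" "i \<in> I" "j \<in> I" "i \<noteq> j"
  shows "indep_var N (X i) N (X j)"
proof -
  have "indep_var N ((\<lambda>h. h i) \<circ> (\<lambda>\<omega>. restrict (\<lambda>k. X k \<omega>) {i}))
                  N ((\<lambda>h. h j) \<circ> (\<lambda>\<omega>. restrict (\<lambda>k. X k \<omega>) {j}))"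
    using assms by (intro indep_var_compose[OF indep_var_restrict[OF assms(1)]]) auto
  thus ?thesis
    by (simp add: comp_def)
qed

lemma iid_pair_density:
  fixes f :: "'a::euclidean_space \<Rightarrow> real"
  assumes "prob_space M" and iid: "iid_with_density M n X f"
    and nonneg: "\<And>x. 0 \<le> f x"
    and ij: "i \<in> {1..n}" "j \<in> {1..n}" "i \<noteq> j"
  shows "distributed M lborel (\<lambda>\<omega>. (X i \<omega>, X j \<omega>)) (\<lambda>(x, y). ennreal (f x * f y))"
proof -
  interpret prob_space M by fact
  have "indep_var lborel (X i) lborel (X j)"
    using indep_var_of_indep_vars[of borel X "{1..n}" i j] iid ij
    by (simp add: iid_with_density_def indep_var_eq)
  hence "distributed M (lborel \<Otimes>\<^sub>M lborel) (\<lambda>\<omega>. (X i \<omega>, X j \<omega>)) (\<lambda>(x, y). ennreal (f x) * ennreal (f y))"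
    using iid ij by (intro distributed_joint_indep)
      (auto simp: iid_with_density_def lborel.sigma_finite_measure_axioms)
  thus ?thesis
    using nonneg by (simp add: lborel_prod ennreal_mult)
qed

lemma AE_lborel_off_diagonal: "AE (x, y) in (lborel :: ('a::euclidean_space \<times> 'a) measure). x \<noteq> y"
proof -
  have "AE p in lborel \<Otimes>\<^sub>M lborel. fst p \<noteq> (snd p :: 'a)"
  proof (rule lborel_pair.AE_pair_measure)
    show "{p \<in> space (lborel \<Otimes>\<^sub>M lborel). fst p \<noteq> (snd p :: 'a)} \<in> sets (lborel \<Otimes>\<^sub>M lborel)"
      by measurable
    show "AE x in lborel. AE y in lborel. fst (x, y) \<noteq> (snd (x, y) :: 'a)"
    proof (rule AE_I2)
      fix x :: 'a
      show "AE y in lborel. fst (x, y) \<noteq> (snd (x, y) :: 'a)"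
        using AE_lborel_singleton[of x] by eventually_elim auto
    qed
  qed
  thus ?thesis
    unfolding lborel_prod by (simp add: case_prod_beta)
qed

lemma AE_sample_inj:
  fixes f :: "'a::euclidean_space \<Rightarrow> real"
  assumes "prob_space M" and iid: "iid_with_density M n X f"
    and nonneg: "\<And>x. 0 \<le> f x"
  shows "AE \<omega> in M. inj_on (\<lambda>i. X i \<omega>) {1..n}"
proof -
  have "AE \<omega> in M. X i \<omega> \<noteq> X j \<omega>" if "i \<in> {1..n}" "j \<in> {1..n}" "i \<noteq> j" for i j
  proof -
    note d = iid_pair_density[OF assms that]
    have "AE p in density lborel (\<lambda>(x, y). ennreal (f x * f y)). fst p \<noteq> snd p"
      using AE_lborel_off_diagonal[where 'a='a] distributed_borel_measurable[OF d]
      by (subst AE_density) (auto elim!: eventually_mono)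
    hence "AE p in distr M lborel (\<lambda>\<omega>. (X i \<omega>, X j \<omega>)). fst p \<noteq> snd p"
      unfolding distributed_distr_eq_density[OF d] .
    moreover have "{p :: 'a \<times> 'a. fst p \<noteq> snd p} \<in> sets borel"
      by (intro borel_open open_Collect_neq continuous_intros)
    ultimately show ?thesis
      using distributed_measurable[OF d] by (subst (asm) AE_distr_iff) auto
  qed
  hence "AE \<omega> in M. \<forall>i\<in>{1..n}. \<forall>j\<in>{1..n}. i \<noteq> j \<longrightarrow> X i \<omega> \<noteq> X j \<omega>"
    by (intro AE_finite_allI) (auto intro: AE_I2)
  thus ?thesis
    by (elim eventually_mono) (auto simp: inj_on_def)
qed

lemma measurable_L_sample:
  assumes X: "\<And>i. i \<in> {1..n} \<Longrightarrow> X i \<in> borel_measurable M"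
  shows "L_sample r \<beta> n (X :: nat \<Rightarrow> 'w \<Rightarrow> 'a::euclidean_space) \<in> borel_measurable M"
proof -
  \<comment> \<open>Only the variables with index in \<open>{1..n}\<close> are known to be measurable, so replace the others.\<close>
  define Y where "Y i = (if i \<in> {1..n} then X i else (\<lambda>_. 0))" for i
  have [measurable]: "Y i \<in> borel_measurable M" for i
    using X by (auto simp: Y_def)
  have "sample_points n X \<omega> = sample_points n Y \<omega>" for \<omega>
    unfolding sample_points_def by (intro image_cong) (auto simp: Y_def)
  hence "L_sample r \<beta> n X = L_sample r \<beta> n Y"
    by (simp add: L_sample_def fun_eq_iff)
  also have "\<dots> \<in> borel_measurable M"
    unfolding L_sample_eq_sum_first_indices[abs_def] by measurable
  finally show ?thesis .
qed

lemma expectation_L_sample: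
  fixes f :: "'a::euclidean_space \<Rightarrow> real"
  defines "F \<equiv> \<lambda>r \<beta> (x, y). edge_weight r \<beta> x y * f x * f y"
  assumes M: "prob_space M" and iid: "iid_with_density M n X f"
    and nonneg: "\<And>x. 0 \<le> f x"
    and int: "integrable lborel (F r \<beta>)"
  shows "integrable M (L_sample r \<beta> n X)"
    and "(LINT \<omega>|M. L_sample r \<beta> n X \<omega>) = real n * (real n - 1) / 2 * integral\<^sup>L lborel (F r \<beta>)"
proof -
  interpret prob_space M by fact
  let ?S = "\<lambda>\<omega>. 1 / 2 * (\<Sum>i\<in>{1..n}. \<Sum>j\<in>{1..n} - {i}. edge_weight r \<beta> (X i \<omega>) (X j \<omega>))"
  have X: "X i \<in> borel_measurable M" if "i \<in> {1..n}" for i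
    using iid that distributed_measurable[of M lborel "X i" "\<lambda>x. ennreal (f x)"]
    by (simp add: iid_with_density_def)
  have pair: "has_bochner_integral M (\<lambda>\<omega>. edge_weight r \<beta> (X i \<omega>) (X j \<omega>)) (integral\<^sup>L lborel (F r \<beta>))"
    if ij: "i \<in> {1..n}" "j \<in> {1..n}" "i \<noteq> j" for i j
  proof -
    let ?g = "\<lambda>p. edge_weight r \<beta> (fst p) (snd p)" and ?p = "\<lambda>p. f (fst p) * f (snd p)"
    have d: "distributed M lborel (\<lambda>\<omega>. (X i \<omega>, X j \<omega>)) (\<lambda>p. ennreal (?p p))"
      using iid_pair_density[OF M iid nonneg ij] by (simp add: case_prod_beta')
    have g: "?g \<in> borel_measurable (lborel :: ('a \<times> 'a) measure)"
      by (intro measurable_edge_weight; simp; intro borel_measurable_continuous_onI continuous_intros)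
    have F: "F r \<beta> = (\<lambda>p. ?p p * ?g p)"
      by (auto simp: F_def)
    show ?thesis
      using distributed_integrable[OF d g] distributed_integral[OF d g] int nonneg
      by (simp add: has_bochner_integral_iff F)
  qed
  have S: "has_bochner_integral M ?S
      (1 / 2 * (\<Sum>i\<in>{1..n}. \<Sum>j\<in>{1..n} - {i}. integral\<^sup>L lborel (F r \<beta>)))"
    by (intro has_bochner_integral_mult_right has_bochner_integral_sum pair) auto
  have meas: "L_sample r \<beta> n X \<in> borel_measurable M"
    using X by (rule measurable_L_sample)
  have AE: "AE \<omega> in M. L_sample r \<beta> n X \<omega> = ?S \<omega>"
    using AE_sample_inj[OF M iid nonneg]
  proof eventually_elim
    case (elim \<omega>)
    have first: "of_bool (\<forall>k\<in>{1..<i}. X k \<omega> \<noteq> X i \<omega>) = (1 :: real)" if "i \<in> {1..n}" for i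
    proof (intro of_bool_eq_1_iff[THEN iffD2] ballI)
      fix k assume "k \<in> {1..<i}"
      with that have "k \<in> {1..n}" "k \<noteq> i" by simp_all
      thus "X k \<omega> \<noteq> X i \<omega>"
        using inj_onD[OF elim _ _ that] by blast
    qed
    have "L_sample r \<beta> n X \<omega> = 1 / 2 * (\<Sum>i\<in>{1..n}. \<Sum>j\<in>{1..n}. edge_weight r \<beta> (X i \<omega>) (X j \<omega>))"
      unfolding L_sample_eq_sum_first_indices
      by (simp only: first mult_1_left cong: sum.cong)
    thus ?case
      by (simp add: sum_diff1)
  qed
  have "has_bochner_integral M (L_sample r \<beta> n X)
      (1 / 2 * (\<Sum>i\<in>{1..n}. \<Sum>j\<in>{1..n} - {i}. integral\<^sup>L lborel (F r \<beta>)))"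
    by (rule has_bochner_integral_cong_AE[THEN iffD2, OF meas borel_measurable_has_bochner_integral[OF S] AE S])
  moreover have "(1 / 2 * (\<Sum>i\<in>{1..n}. \<Sum>j\<in>{1..n} - {i}. integral\<^sup>L lborel (F r \<beta>))) = 
      real n * (real n - 1) / 2 * integral\<^sup>L lborel (F r \<beta>)"
    by (cases n) (simp_all add: sum_distrib_left[symmetric])
  ultimately show "integrable M (L_sample r \<beta> n X)"
      "(LINT \<omega>|M. L_sample r \<beta> n X \<omega>) = real n * (real n - 1) / 2 * integral\<^sup>L lborel (F r \<beta>)"
    by (simp_all add: has_bochner_integral_iff)
qed

section \<open>The expectation and its limit\<close>

text \<open>For Borel functions supported in \<open>S\<close> the integrals over \<open>S\<close> with respect to the
  completed measure are integrals with respect to \<open>lborel\<close>, for which Fubini and translation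
  invariance are available.\<close>

lemma set_integral_lebesgue_eq_lborel:
  fixes g :: "'a::euclidean_space \<Rightarrow> real"
  assumes g: "g \<in> borel_measurable borel" and supp: "\<And>x. x \<notin> S \<Longrightarrow> g x = 0"
  shows "set_integrable lebesgue S g \<longleftrightarrow> integrable lborel g"
    and "set_lebesgue_integral lebesgue S g = integral\<^sup>L lborel g"
proof -
  have "(\<lambda>x. indicator S x *\<^sub>R g x) = g"
    using supp by (auto simp: indicator_def fun_eq_iff)
  thus "set_integrable lebesgue S g \<longleftrightarrow> integrable lborel g"
      "set_lebesgue_integral lebesgue S g = integral\<^sup>L lborel g"
    using g by (simp_all add: set_integrable_def set_lebesgue_integral_def integrable_completion integral_completion)
qed

theorem theorem2p1:
  fixes W :: "(real ^ 'd) set"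
    and f :: "real ^ 'd \<Rightarrow> real"
    and M :: "nat \<Rightarrow> 'w measure"
    and X :: "nat \<Rightarrow> nat \<Rightarrow> 'w \<Rightarrow> real ^ 'd"
    and r :: "nat \<Rightarrow> real"
    and \<beta> :: real
  assumes W: "W \<in> sets lebesgue" "emeasure lebesgue W = 1"
    and f: "prob_density f" "{x. f x \<noteq> 0} \<subseteq> W"
    and M: "\<And>n. n \<ge> 2 \<Longrightarrow> prob_space (M n)"
    and X: "\<And>n. n \<ge> 2 \<Longrightarrow> iid_with_density (M n) n (X n) f"
    and r: "\<And>n. n \<ge> 2 \<Longrightarrow> r n > 0" "r \<longlonglongrightarrow> 0"
    and \<beta>: "\<beta> > - real CARD('d)"
    and f_L2: "f \<in> Lp_space 2 W"
  shows "(\<forall>n\<ge>2.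
            integrable (M n) (L_sample (r n) \<beta> n (X n)) \<and>
            set_integrable lebesgue (W \<times> W) (\<lambda>(x, y). edge_weight (r n) \<beta> x y * f x * f y) \<and>
            (LINT \<omega>|M n. L_sample (r n) \<beta> n (X n) \<omega>) =
              real n * (real n - 1) / 2 *
              set_lebesgue_integral lebesgue (W \<times> W)
                (\<lambda>(x, y). edge_weight (r n) \<beta> x y * f x * f y)) \<and>
         (\<lambda>n. (LINT \<omega>|M n. L_sample (r n) \<beta> n (X n) \<omega>) /
               ((real n)\<^sup>2 * r n powr (\<beta> + real CARD('d))))
           \<longlonglongrightarrow> real CARD('d) * unit_ball_vol (real CARD('d)) / (2 * (\<beta> + real CARD('d)))
               * set_lebesgue_integral lebesgue W (\<lambda>x. (f x)\<^sup>2)"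
proof -
  let ?d = "real CARD('d)"
  let ?F = "\<lambda>n (x, y). edge_weight (r n) \<beta> x y * f x * f y"
  let ?J = "\<lambda>s. \<integral>\<^sup>+x. \<integral>\<^sup>+y. ennreal (edge_weight s \<beta> x y * f x * f y) \<partial>lborel \<partial>lborel"
  define q where "q = (LINT x|lborel. (f x)\<^sup>2)"
  define C where "C = ?d * unit_ball_vol ?d / (\<beta> + ?d)"
  have f_meas[measurable]: "f \<in> borel_measurable borel" and nonneg: "\<And>x. 0 \<le> f x"
    using f(1) by (auto simp: prob_density_def)
  have supp: "f x = 0" if "x \<notin> W" for x
    using f(2) that by auto
  have "set_integrable lebesgue W (\<lambda>x. (f x)\<^sup>2)"
    using f_L2 nonneg by (simp add: Lp_space_def)
  hence sq_int: "integrable lborel (\<lambda>x. (f x)\<^sup>2)"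
    using set_integral_lebesgue_eq_lborel(1)[of "\<lambda>x. (f x)\<^sup>2" W] supp by simp
  hence Q: "(\<integral>\<^sup>+x. ennreal ((f x)\<^sup>2) \<partial>lborel) = ennreal q"
    unfolding q_def by (intro nn_integral_eq_integral) auto
  have "q \<ge> 0"
    unfolding q_def by (rule integral_nonneg_AE) auto
  have q: "set_lebesgue_integral lebesgue W (\<lambda>x. (f x)\<^sup>2) = q"
    unfolding q_def by (rule set_integral_lebesgue_eq_lborel(2)) (use supp in auto)
  have \<beta>': "\<beta> > - real DIM(real ^ 'd)"
    using \<beta> by simp
  have F_meas[measurable]: "?F n \<in> borel_measurable borel" for n
    by (subst borel_prod[symmetric]) measurable
  have F_nonneg: "0 \<le> ?F n p" for n p
    using nonneg by (auto split: prod.splits)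
  have F_nn: "(\<integral>\<^sup>+p. ennreal (?F n p) \<partial>lborel) = ?J (r n)" for n
  proof -
    have "?J (r n) = (\<integral>\<^sup>+x. \<integral>\<^sup>+y. ennreal (?F n (x, y)) \<partial>lborel \<partial>lborel)"
      by simp
    also have "\<dots> = (\<integral>\<^sup>+p. ennreal (?F n p) \<partial>(lborel \<Otimes>\<^sub>M lborel))"
      by (rule lborel.nn_integral_fst) (simp add: lborel_prod)
    finally show ?thesis
      by (simp add: lborel_prod)
  qed
  have F_int: "integrable lborel (?F n)" if "n \<ge> 2" for n
  proof (rule integrableI_nonneg)
    have "?J (r n) \<le> ennreal (C * r n powr (\<beta> + ?d) * q)"
      using edge_weight_density_le[OF f_meas nonneg Q \<open>q \<ge> 0\<close> \<beta>' r(1)[OF that]] by (simp add: C_def)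
    also have "\<dots> < \<infinity>" by simp
    finally show "(\<integral>\<^sup>+p. ennreal (?F n p) \<partial>lborel) < \<infinity>"
      by (simp only: F_nn)
  qed (use F_nonneg in auto)
  have F_eq: "integral\<^sup>L lborel (?F n) = enn2real (?J (r n))" for n
    unfolding F_nn[symmetric] using F_nonneg by (intro integral_eq_nn_integral) auto
  have F_supp: "?F n p = 0" if "p \<notin> W \<times> W" for n p
    using that supp by (cases p) auto
  have E: "integrable (M n) (L_sample (r n) \<beta> n (X n))"
       "(LINT \<omega>|M n. L_sample (r n) \<beta> n (X n) \<omega>) =
          real n * (real n - 1) / 2 * integral\<^sup>L lborel (?F n)" if "n \<ge> 2" for n
    using expectation_L_sample[OF M[OF that] X[OF that] nonneg F_int[OF that]] by auto

  have "eventually (\<lambda>n. r n > 0) sequentially"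
    using eventually_ge_at_top[of 2] by eventually_elim (rule r(1))
  hence J_lim: "(\<lambda>n. enn2real (?J (r n)) / r n powr (\<beta> + ?d)) \<longlonglongrightarrow> C * q"
    using edge_weight_density_tendsto[OF f_meas nonneg Q \<open>q \<ge> 0\<close> \<beta>' r(2)] by (simp add: C_def)
  \<comment> \<open>The factor \<open>1 - 1 / n\<close> is \<open>n (n - 1) / n\<^sup>2\<close>.\<close>
  have "(\<lambda>n. (1 - 1 / real n) / 2 * (enn2real (?J (r n)) / r n powr (\<beta> + ?d))) \<longlonglongrightarrow> (1 - 0) / 2 * (C * q)"
    by (intro tendsto_mult J_lim tendsto_divide tendsto_diff tendsto_const lim_1_over_n) auto
  moreover have "\<forall>\<^sub>F n in sequentially. (1 - 1 / real n) / 2 * (enn2real (?J (r n)) / r n powr (\<beta> + ?d)) =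
      (LINT \<omega>|M n. L_sample (r n) \<beta> n (X n) \<omega>) / ((real n)\<^sup>2 * r n powr (\<beta> + ?d))"
    using eventually_ge_at_top[of 2]
  proof eventually_elim
    case (elim n)
    show ?case
      using elim r(1)[OF elim] unfolding E(2)[OF elim] F_eq
      by (simp add: field_simps power2_eq_square)
  qed
  ultimately have "(\<lambda>n. (LINT \<omega>|M n. L_sample (r n) \<beta> n (X n) \<omega>) / ((real n)\<^sup>2 * r n powr (\<beta> + ?d)))
      \<longlonglongrightarrow> (1 - 0) / 2 * (C * q)"
    by (rule Lim_transform_eventually)
  also have "(1 - 0) / 2 * (C * q) = ?d * unit_ball_vol ?d / (2 * (\<beta> + ?d)) *
      set_lebesgue_integral lebesgue W (\<lambda>x. (f x)\<^sup>2)"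
    by (simp add: C_def q)
  finally show ?thesis
    using E F_int set_integral_lebesgue_eq_lborel[OF F_meas F_supp] by auto
qed

end
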